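(* Let $d \geq 2$ and $N$ be integers, let $0 < c_1 < c_2$ be real numbers, and let $\sigma \geq 0$. Assume that $\sigma < c_1/\sqrt{2d}$ and that $N > 2 d c_2^2 / c_1^2$. Then $$\max_{\substack{v_1, \ldots, v_N \in \mathbb{R}^d \\ c_1 \leq |v_i|^2 \leq c_2 \ \forall i}} \ \min_{1 \leq k \leq N} \log\left(1 + \frac{|v_k|^2}{\sigma^2 + \sum_{l \neq k} \langle v_k, v_l \rangle^2}\right) \leq \log\left(1 + \frac{d}{c_1(N-d) + \sigma^2 \cdot \frac{d}{c_1} - \frac{d^2}{c_1 N}(c_2^2 - c_1^2)\frac{c_1^2 - \sigma^2}{c_1^2 - d\sigma^2}}\right).$$
   Context: $|\cdot|$ and $\langle \cdot,\cdot\rangle$ are the Euclidean norm and inner product on $\mathbb{R}^d$. Sums $\sum_{l \neq k}$ run over $l \in \{1,\ldots,N\}\setminus\{k\}$. Convention: a positive number divided by $0$ equals $+\infty$, and $\log(+\infty)=+\infty$. The logarithm is taken to any fixed base greater than $1$ (the same on both sides). Vector systems are indexed families (repetitions are allowed). *)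

theory Defs
  imports "HOL-Analysis.Analysis"
begin

text \<open>Quotients are formed in \<^typ>\<open>ereal\<close>, where a positive number divided by \<open>0\<close> is \<open>\<infinity>\<close>.
  Only arguments in \<open>[1, \<infinity>]\<close> matter for the logarithm below.\<close>

definition ext_log :: "real \<Rightarrow> ereal \<Rightarrow> ereal" where
  "ext_log b x = (if x = \<infinity> then \<infinity> else ereal (log b (real_of_ereal x)))"

definition admissible :: "nat \<Rightarrow> real \<Rightarrow> real \<Rightarrow> (nat \<Rightarrow> real ^ 'd) set" where
  "admissible N c1 c2 = {1..N} \<rightarrow>\<^sub>E {x. c1 \<le> (norm x)\<^sup>2 \<and> (norm x)\<^sup>2 \<le> c2}"

definition min_rate :: "real \<Rightarrow> real \<Rightarrow> nat \<Rightarrow> (nat \<Rightarrow> real ^ 'd) \<Rightarrow> ereal" where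
  "min_rate b \<sigma> N v =
     (MIN k\<in>{1..N}. ext_log b
        (1 + ereal ((norm (v k))\<^sup>2) / ereal (\<sigma>\<^sup>2 + (\<Sum>l\<in>{1..N} - {k}. (v k \<bullet> v l)\<^sup>2))))"

end

theory Submission
  imports Defs
begin

text \<open>Write \<open>a\<^sub>k = |v\<^sub>k|\<^sup>2\<close>, let \<open>S\<^sub>k\<close> be the denominator of the \<open>k\<close>-th rate and
  \<open>A = \<Sum>\<^sub>k a\<^sub>k\<close>. The Welch bound
  \<open>A\<^sup>2 \<le> d \<Sum>\<^sub>k\<^sub>,\<^sub>l \<langle>v\<^sub>k, v\<^sub>l\<rangle>\<^sup>2\<close> and \<open>a\<^sub>k\<^sup>2 \<le> (c\<^sub>1 + c\<^sub>2) a\<^sub>k - c\<^sub>1 c\<^sub>2\<close> bound \<open>\<Sum>\<^sub>k S\<^sub>k\<close> from below by a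
  quadratic in \<open>A\<close>, whose value at \<open>A \<ge> N c\<^sub>1\<close> shows that some ratio \<open>S\<^sub>k / a\<^sub>k\<close> is at least
  \<open>(c\<^sub>1 (N - d) + \<sigma>\<^sup>2 d / c\<^sub>1) / d\<close>. This is already stronger than the stated bound: the term
  subtracted there is nonnegative, and the assumption on \<open>N\<close> keeps the denominator positive.
  The maximum is attained because the rate is a decreasing function of the ratio \<open>S\<^sub>k / a\<^sub>k\<close>,
  which, unlike \<open>a\<^sub>k / S\<^sub>k\<close>, is a finite continuous function of the vectors.\<close>

text \<open>The matrix \<open>F\<close>, the sum of the rank-one matrices of the vectors, has trace
  equal to the sum of the squared norms and the same Frobenius norm as the Gram matrix.
  Cauchy-Schwarz on its diagonal, followed by adding the squares of the off-diagonal entries, gives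
  the bound.\<close>

lemma frame_potential_ge:
  fixes v :: "'i \<Rightarrow> real ^ 'd"
  shows "(\<Sum>i\<in>I. (norm (v i))\<^sup>2)\<^sup>2 \<le> real CARD('d) * (\<Sum>k\<in>I. \<Sum>l\<in>I. (v k \<bullet> v l)\<^sup>2)"
proof -
  define F where "F = (\<lambda>i j. \<Sum>k\<in>I. v k $ i * v k $ j)"
  have "(\<Sum>k\<in>I. \<Sum>l\<in>I. (v k \<bullet> v l)\<^sup>2)
      = (\<Sum>k\<in>I. \<Sum>l\<in>I. \<Sum>i\<in>UNIV. \<Sum>j\<in>UNIV. (v k $ i * v k $ j) * (v l $ i * v l $ j))"
    by (simp add: inner_vec_def power2_eq_square sum_product mult_ac)
  also have "\<dots> = (\<Sum>i\<in>UNIV. \<Sum>k\<in>I. \<Sum>l\<in>I. \<Sum>j\<in>UNIV. (v k $ i * v k $ j) * (v l $ i * v l $ j))"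
    by (subst (2) sum.swap, subst sum.swap) simp
  also have "\<dots> = (\<Sum>i\<in>UNIV. \<Sum>j\<in>UNIV. \<Sum>k\<in>I. \<Sum>l\<in>I. (v k $ i * v k $ j) * (v l $ i * v l $ j))"
    by (subst (2) sum.swap, subst (3) sum.swap) simp
  also have "\<dots> = (\<Sum>i\<in>UNIV. \<Sum>j\<in>UNIV. (F i j)\<^sup>2)"
    by (simp add: F_def power2_eq_square sum_product)
  finally have pot: "(\<Sum>k\<in>I. \<Sum>l\<in>I. (v k \<bullet> v l)\<^sup>2) = (\<Sum>i\<in>UNIV. \<Sum>j\<in>UNIV. (F i j)\<^sup>2)" .
  have "(\<Sum>i\<in>I. (norm (v i))\<^sup>2) = (\<Sum>i\<in>UNIV. F i i)"
    unfolding F_def power2_norm_eq_inner inner_vec_def inner_real_def by (rule sum.swap)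
  then have "(\<Sum>i\<in>I. (norm (v i))\<^sup>2)\<^sup>2 \<le> real CARD('d) * (\<Sum>i\<in>UNIV. (F i i)\<^sup>2)"
    using sum_squared_le_sum_of_squares[of "\<lambda>i. F i i" "UNIV :: 'd set"] by (simp add: mult.commute)
  also have "\<dots> \<le> real CARD('d) * (\<Sum>i\<in>UNIV. \<Sum>j\<in>UNIV. (F i j)\<^sup>2)"
    by (intro mult_left_mono sum_mono member_le_sum) auto
  finally show ?thesis by (simp add: pot)
qed

text \<open>Comparing \<open>s / a\<close> instead of \<open>a / s\<close> keeps the hypothesis in
  real arithmetic. An infinite rate corresponds to ratio \<open>0\<close>, and \<open>s' = 0\<close>
  forces \<open>s = 0\<close>.\<close>

lemma ext_log_rate_antimono:
  assumes "b > 1" "a > 0" "a' > 0" "s \<ge> 0" "s' \<ge> 0" "s / a \<le> s' / a'"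
  shows "ext_log b (1 + ereal a' / ereal s') \<le> ext_log b (1 + ereal a / ereal s)"
proof (cases "s = 0")
  case True
  then show ?thesis using assms by (simp add: ext_log_def)
next
  case False
  then have "0 < s / a"
    using assms by simp
  then have "0 < s' / a'"
    using assms by linarith
  then have "s' > 0"
    using assms by (simp add: zero_less_divide_iff)
  moreover have "a' / s' \<le> a / s"
    using assms le_imp_inverse_le[OF _ \<open>0 < s / a\<close>] by fastforce
  moreover have "0 < a' / s'"
    using \<open>s' > 0\<close> assms by simp
  ultimately have "log b (1 + a' / s') \<le> log b (1 + a / s)"
    using \<open>b > 1\<close> by (subst log_le_cancel_iff) linarith+
  then show ?thesis using False \<open>s' > 0\<close> by (simp add: ext_log_def one_ereal_def)
qed

lemma continuous_on_Max_image:
  fixes f :: "'i \<Rightarrow> 'a::topological_space \<Rightarrow> real"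
  assumes "finite I" "I \<noteq> {}" "\<And>i. i \<in> I \<Longrightarrow> continuous_on S (f i)"
  shows "continuous_on S (\<lambda>x. Max ((\<lambda>i. f i x) ` I))"
  using assms by (induction I rule: finite_ne_induct) (auto intro!: continuous_on_max)

lemma compact_admissible: "compact (admissible N c1 c2 :: (nat \<Rightarrow> real ^ 'd) set)"
proof -
  let ?B = "{x :: real ^ 'd. c1 \<le> (norm x)\<^sup>2 \<and> (norm x)\<^sup>2 \<le> c2}"
  have "closed ?B"
    by (intro closed_Collect_conj closed_Collect_le continuous_intros)
  moreover have "bounded ?B"
    unfolding bounded_iff by (auto intro!: exI[of _ "sqrt c2"] real_le_rsqrt)
  ultimately have "compact ?B"
    by (simp add: compact_eq_bounded_closed)
  \<comment> \<open>Members of \<open>admissible\<close> are \<open>undefined\<close> outside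
    \<open>{1..N}\<close>. With singleton factors there, the set is a full product of compact sets,
    and Tychonoff applies.\<close>
  moreover have "admissible N c1 c2 = PiE UNIV (\<lambda>i. if i \<in> {1..N} then ?B else {undefined})"
    unfolding admissible_def PiE_def Pi_def extensional_def by (auto split: if_splits)
  ultimately show ?thesis
    by (simp add: compactin_PiE flip: compactin_euclidean_iff euclidean_product_topology)
qed

lemma admissible_nonempty:
  assumes "0 \<le> c1" "c1 \<le> c2"
  shows "(admissible N c1 c2 :: (nat \<Rightarrow> real ^ 'd) set) \<noteq> {}"
proof -
  obtain x :: "real ^ 'd" where "norm x = sqrt c1"
    using vector_choose_size[of "sqrt c1"] assms by auto
  with assms have "(\<lambda>i\<in>{1..N}. x) \<in> admissible N c1 c2"
    by (auto simp: admissible_def)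
  then show ?thesis by blast
qed

definition noise :: "real \<Rightarrow> nat \<Rightarrow> (nat \<Rightarrow> real ^ 'd) \<Rightarrow> nat \<Rightarrow> real" where
  "noise \<sigma> N v k = \<sigma>\<^sup>2 + (\<Sum>l\<in>{1..N} - {k}. (v k \<bullet> v l)\<^sup>2)"

lemma noise_nonneg: "0 \<le> noise \<sigma> N v k"
  by (simp add: noise_def sum_nonneg)

lemma ex_min_rate_arg_max:
  assumes "b > 1" "0 < c1" "c1 \<le> c2" "N > 0"
  shows "\<exists>v :: nat \<Rightarrow> real ^ 'd. is_arg_max (min_rate b \<sigma> N) (\<lambda>v. v \<in> admissible N c1 c2) v"
proof -
  let ?h = "\<lambda>k v. noise \<sigma> N v k / (norm (v k))\<^sup>2"
  let ?adm = "admissible N c1 c2 :: (nat \<Rightarrow> real ^ 'd) set"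
  \<comment> \<open>The largest ratio gives the smallest rate, so a minimiser of \<open>G\<close> is
    a maximiser of \<open>min_rate\<close>.\<close>
  define G where "G = (\<lambda>v :: nat \<Rightarrow> real ^ 'd. Max ((\<lambda>k. ?h k v) ` {1..N}))"
  have pos: "0 < (norm (v k))\<^sup>2" if "v \<in> ?adm" "k \<in> {1..N}" for v k
    using that assms by (fastforce simp: admissible_def dest: PiE_mem)
  have coord: "continuous_on S (\<lambda>v. v k)" for S :: "(nat \<Rightarrow> real ^ 'd) set" and k
    by (rule continuous_on_subset[OF continuous_on_product_coordinates]) simp
  have "continuous_on ?adm (?h k)" if "k \<in> {1..N}" for k
    unfolding noise_def using pos that by (intro continuous_intros coord) fastforce
  then have "continuous_on ?adm G"
    unfolding G_def using assms by (intro continuous_on_Max_image) auto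
  then obtain v where v: "v \<in> ?adm" and v_min: "\<And>w. w \<in> ?adm \<Longrightarrow> G v \<le> G w"
    using continuous_attains_inf[OF compact_admissible admissible_nonempty, of c1 c2 N G] assms
    by auto
  have "min_rate b \<sigma> N w \<le> min_rate b \<sigma> N v" if w: "w \<in> ?adm" for w
  proof -
    have "G w \<in> (\<lambda>k. ?h k w) ` {1..N}"
      unfolding G_def using assms by (intro Max_in) auto
    then obtain k where k: "k \<in> {1..N}" "G w = ?h k w" by blast
    let ?r = "\<lambda>v k. ext_log b (1 + ereal ((norm (v k))\<^sup>2) / ereal (noise \<sigma> N v k))"
    have "min_rate b \<sigma> N w \<le> ?r w k"
      unfolding min_rate_def noise_def using k by (intro Min_le) auto
    \<comment> \<open>Here \<open>k\<close> is the worst index of \<open>w\<close>, and each ratio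
      of \<open>v\<close> is at most \<open>G v \<le> G w\<close>.\<close>
    moreover have "?r w k \<le> ?r v j" if j: "j \<in> {1..N}" for j
    proof -
      have "?h j v \<le> G v"
        unfolding G_def using j by (intro Max_ge) auto
      also have "\<dots> \<le> ?h k w"
        using v_min[OF w] k by simp
      finally show ?thesis
        using assms pos v w j k by (intro ext_log_rate_antimono noise_nonneg) auto
    qed
    ultimately have "\<forall>j\<in>{1..N}. min_rate b \<sigma> N w \<le> ?r v j"
      by (meson order.trans)
    then show ?thesis
      unfolding min_rate_def[of _ _ _ v] noise_def[symmetric] using assms
      by (intro Min.boundedI) (auto simp del: ereal_divide)
  qed
  with v show ?thesis
    by (auto simp: is_arg_max_def not_less)
qed

text \<open>If every ratio were below the claimed value \<open>M\<close>, summing would give total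
  noise below \<open>M * A\<close>. The difference of the lower bound for the total noise and
  \<open>M * A\<close> is a quadratic in \<open>A\<close> with roots \<open>real N * c1\<close> and
  \<open>d * (c2 + \<sigma>\<^sup>2 / c1)\<close>. The last hypothesis puts the second root below
  the first, so the difference is nonnegative for all attainable \<open>A\<close>.\<close>

lemma ex_large_noise_ratio:
  fixes v :: "nat \<Rightarrow> real ^ 'd" and c1 c2 \<sigma> :: real
  defines "d \<equiv> real CARD('d)"
  assumes v: "v \<in> admissible N c1 c2" and "0 < c1" "c1 \<le> c2" "N > 0"
    and N: "d * (c2 + \<sigma>\<^sup>2 / c1) \<le> real N * c1"
  shows "\<exists>k\<in>{1..N}. (c1 * (real N - d) + \<sigma>\<^sup>2 * (d / c1)) / d \<le> noise \<sigma> N v k / (norm (v k))\<^sup>2"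
proof (rule ccontr)
  define M where "M = (c1 * (real N - d) + \<sigma>\<^sup>2 * (d / c1)) / d"
  define a where "a = (\<lambda>k. (norm (v k))\<^sup>2)"
  define A where "A = (\<Sum>k\<in>{1..N}. a k)"
  have "d > 0" by (simp add: d_def)
  have a: "c1 \<le> a k" "a k \<le> c2" if "k \<in> {1..N}" for k
    using PiE_mem[OF v[unfolded admissible_def] that] by (simp_all add: a_def)
  have A_ge: "real N * c1 \<le> A"
    unfolding A_def using sum_mono[of "{1..N}" "\<lambda>_. c1" a, OF a(1)] by simp
  \<comment> \<open>Restoring the diagonal term completes the double sum to the one in
    \<open>frame_potential_ge\<close>.\<close>
  have noise_eq: "noise \<sigma> N v k = \<sigma>\<^sup>2 + (\<Sum>l\<in>{1..N}. (v k \<bullet> v l)\<^sup>2) - (a k)\<^sup>2"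
    if "k \<in> {1..N}" for k
    using that sum.remove[of "{1..N}" k "\<lambda>l. (v k \<bullet> v l)\<^sup>2"]
    by (simp add: noise_def a_def power2_norm_eq_inner)
  assume "\<not> ?thesis"
  then have lt: "noise \<sigma> N v k / a k < M" if "k \<in> {1..N}" for k
    using that by (auto simp: M_def a_def not_le)
  have noise_less: "noise \<sigma> N v k < M * a k" if "k \<in> {1..N}" for k
    using lt[OF that] a(1)[OF that] \<open>0 < c1\<close> by (simp add: divide_less_eq)
  \<comment> \<open>On \<open>[c1, c2]\<close> the square lies below its chord; the sum of the
    squares is thus bounded by an affine function of \<open>A\<close>.\<close>
  have sq: "(a k)\<^sup>2 \<le> (c1 + c2) * a k - c1 * c2" if "k \<in> {1..N}" for k
  proof -
    have "0 \<le> (a k - c1) * (c2 - a k)"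
      using a[OF that] by simp
    then show ?thesis by (simp add: algebra_simps power2_eq_square)
  qed
  have "real N * \<sigma>\<^sup>2 + A\<^sup>2 / d - ((c1 + c2) * A - real N * (c1 * c2))
      \<le> real N * \<sigma>\<^sup>2 + (\<Sum>k\<in>{1..N}. \<Sum>l\<in>{1..N}. (v k \<bullet> v l)\<^sup>2) - (\<Sum>k\<in>{1..N}. (a k)\<^sup>2)"
  proof -
    have "A\<^sup>2 / d \<le> (\<Sum>k\<in>{1..N}. \<Sum>l\<in>{1..N}. (v k \<bullet> v l)\<^sup>2)"
      using frame_potential_ge[of v "{1..N}"] \<open>d > 0\<close>
      by (simp add: A_def a_def d_def divide_le_eq mult.commute)
    moreover have "(\<Sum>k\<in>{1..N}. (a k)\<^sup>2) \<le> (c1 + c2) * A - real N * (c1 * c2)"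
      using sum_mono[of "{1..N}", OF sq] by (simp add: A_def sum_subtractf sum_distrib_left)
    ultimately show ?thesis by simp
  qed
  also have "\<dots> = (\<Sum>k\<in>{1..N}. noise \<sigma> N v k)"
    by (simp add: noise_eq sum_subtractf sum.distrib)
  also have "\<dots> < (\<Sum>k\<in>{1..N}. M * a k)"
    using noise_less \<open>N > 0\<close> by (intro sum_strict_mono) auto
  also have "\<dots> = M * A"
    by (simp add: A_def sum_distrib_left)
  finally have "real N * \<sigma>\<^sup>2 + A\<^sup>2 / d - ((c1 + c2) * A - real N * (c1 * c2)) - M * A < 0"
    by simp
  \<comment> \<open>\<open>M\<close> is the value that makes \<open>A = N c\<^sub>1\<close> a root of this quadratic.\<close>
  also have "real N * \<sigma>\<^sup>2 + A\<^sup>2 / d - ((c1 + c2) * A - real N * (c1 * c2)) - M * A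
      = (A - real N * c1) * (A / d - (c2 + \<sigma>\<^sup>2 / c1))"
    using \<open>d > 0\<close> \<open>0 < c1\<close> by (simp add: M_def field_simps power2_eq_square)
  also have "\<dots> \<ge> 0"
  proof -
    have "c2 + \<sigma>\<^sup>2 / c1 \<le> A / d"
      using N A_ge \<open>d > 0\<close> by (simp add: le_divide_eq mult.commute)
    then show ?thesis using A_ge by simp
  qed
  finally show False by simp
qed

text \<open>The maximum is expressed by a maximiser: one exists, and the value there, common to all
  maximisers, obeys the bound.\<close>

theorem theorem5:
  fixes b c1 c2 \<sigma> d :: real and N :: nat
  assumes "b > 1"
    and "CARD('d::finite) \<ge> 2" and "d = real CARD('d)"
    and "0 < c1" and "c1 < c2" and "\<sigma> \<ge> 0"
    and "\<sigma> < c1 / sqrt (2 * d)"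
    and "real N > 2 * d * c2\<^sup>2 / c1\<^sup>2"
  shows "\<exists>v :: nat \<Rightarrow> real ^ 'd.
    is_arg_max (min_rate b \<sigma> N) (\<lambda>v. v \<in> admissible N c1 c2) v \<and>
    min_rate b \<sigma> N v \<le> ext_log b (1 + ereal d /
      ereal (c1 * (real N - d) + \<sigma>\<^sup>2 * (d / c1)
        - d\<^sup>2 / (c1 * real N) * (c2\<^sup>2 - c1\<^sup>2) * ((c1\<^sup>2 - \<sigma>\<^sup>2) / (c1\<^sup>2 - d * \<sigma>\<^sup>2))))"
proof -
  define E where "E = d\<^sup>2 / (c1 * real N) * (c2\<^sup>2 - c1\<^sup>2) * ((c1\<^sup>2 - \<sigma>\<^sup>2) / (c1\<^sup>2 - d * \<sigma>\<^sup>2))"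
  define D0 where "D0 = c1 * (real N - d) + \<sigma>\<^sup>2 * (d / c1)"
  have d: "d \<ge> 2" and c1: "0 < c1" "c1 < c2"
    using assms by auto
  have \<sigma>: "2 * d * \<sigma>\<^sup>2 < c1\<^sup>2"
  proof -
    have "\<sigma>\<^sup>2 < (c1 / sqrt (2 * d))\<^sup>2"
      using assms by (intro power_strict_mono) auto
    then show ?thesis
      using d by (simp add: power_divide field_simps)
  qed
  have N: "2 * d * c2\<^sup>2 < real N * c1\<^sup>2"
    using assms by (simp add: divide_less_eq)
  have sq: "c1\<^sup>2 < c2\<^sup>2"
    using c1 by (simp add: power_strict_mono)
  have "\<sigma>\<^sup>2 \<le> d * \<sigma>\<^sup>2" "0 \<le> d * \<sigma>\<^sup>2"
    using d by (auto simp: mult_le_cancel_right1)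
  then have gap: "0 < c1\<^sup>2 - d * \<sigma>\<^sup>2" "0 < c1\<^sup>2 - \<sigma>\<^sup>2"
    using \<sigma> c1 by auto
  have "2 * d * c1\<^sup>2 \<le> 2 * d * c2\<^sup>2"
    using sq d by simp
  then have "2 * d * c1\<^sup>2 < real N * c1\<^sup>2"
    using N by linarith
  then have N_gt: "2 * d < real N"
    using c1 by simp
  then have "N > 0"
    using d by (cases N) auto
  have E_nonneg: "0 \<le> E"
    unfolding E_def using gap sq c1 by (intro mult_nonneg_nonneg divide_nonneg_nonneg) auto
  \<comment> \<open>The bound on \<sigma> makes the last quotient in \<open>E\<close> at most
    \<open>2\<close>, and the bound on \<open>N\<close> then gives \<open>E \<le> c1 * d\<close>. As
    \<open>2 * d < real N\<close>, this is less than \<open>c1 * (real N - d)\<close>, hence less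
    than \<open>D0\<close>.\<close>
  have "E \<le> d\<^sup>2 / (c1 * real N) * (c2\<^sup>2 - c1\<^sup>2) * 2"
  proof -
    have "c1\<^sup>2 - \<sigma>\<^sup>2 \<le> 2 * (c1\<^sup>2 - d * \<sigma>\<^sup>2)"
      using \<sigma>[unfolded mult.assoc] zero_le_power2[of \<sigma>] unfolding right_diff_distrib by linarith
    then have "(c1\<^sup>2 - \<sigma>\<^sup>2) / (c1\<^sup>2 - d * \<sigma>\<^sup>2) \<le> 2"
      using gap(1) by (simp only: pos_divide_le_eq)
    then show ?thesis
      unfolding E_def using sq c1 by (intro mult_left_mono) auto
  qed
  also have "\<dots> = d * (2 * d * (c2\<^sup>2 - c1\<^sup>2)) / (c1 * real N)"
    by (simp add: power2_eq_square)
  also have "\<dots> \<le> d * (real N * c1\<^sup>2) / (c1 * real N)"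
  proof -
    have "2 * d * (c2\<^sup>2 - c1\<^sup>2) \<le> 2 * d * c2\<^sup>2"
      using d by simp
    then have "2 * d * (c2\<^sup>2 - c1\<^sup>2) \<le> real N * c1\<^sup>2"
      using N by linarith
    then show ?thesis
      using d c1 by (intro divide_right_mono mult_left_mono) auto
  qed
  also have "\<dots> = c1 * d"
    using \<open>N > 0\<close> c1 by (simp add: power2_eq_square)
  also have "\<dots> < c1 * (real N - d)"
    using c1 N_gt by simp
  also have "\<dots> \<le> D0"
    unfolding D0_def using c1 d by simp
  finally have D_pos: "0 < D0 - E"
    by simp
  \<comment> \<open>After multiplication by \<open>c1\<close>, both \<open>c1 * c2\<close> and
    \<open>\<sigma>\<^sup>2\<close> are at most \<open>c2\<^sup>2\<close>, which accounts for the
    factor \<open>2\<close> in the assumption on \<open>N\<close>.\<close>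
  have "d * (c2 + \<sigma>\<^sup>2 / c1) \<le> real N * c1"
  proof -
    have "c1 * c2 \<le> c2\<^sup>2"
      using c1 by (simp add: power2_eq_square)
    then have "d * (c1 * c2 + \<sigma>\<^sup>2) \<le> d * (2 * c2\<^sup>2)"
      using sq gap d by (intro mult_left_mono) auto
    then have "d * (c1 * c2 + \<sigma>\<^sup>2) \<le> real N * c1\<^sup>2"
      using N by linarith
    then show ?thesis
      using c1 by (simp add: field_simps power2_eq_square)
  qed
  note large = ex_large_noise_ratio[where 'd = 'd, folded \<open>d = real CARD('d)\<close>,
      OF _ c1(1) less_imp_le[OF c1(2)] \<open>N > 0\<close> this, folded D0_def]
  obtain v :: "nat \<Rightarrow> real ^ 'd"
    where v: "is_arg_max (min_rate b \<sigma> N) (\<lambda>v. v \<in> admissible N c1 c2) v"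
    using ex_min_rate_arg_max[of b c1 c2 N \<sigma>] assms(1) c1 \<open>N > 0\<close> by auto
  then have adm: "v \<in> admissible N c1 c2"
    by (simp add: is_arg_max_def)
  then obtain k where k: "k \<in> {1..N}" "D0 / d \<le> noise \<sigma> N v k / (norm (v k))\<^sup>2"
    using large by blast
  have "min_rate b \<sigma> N v \<le> ext_log b (1 + ereal ((norm (v k))\<^sup>2) / ereal (noise \<sigma> N v k))"
    unfolding min_rate_def noise_def using k by (intro Min_le) auto
  also have "\<dots> \<le> ext_log b (1 + ereal d / ereal (D0 - E))"
  proof (rule ext_log_rate_antimono)
    show "0 < (norm (v k))\<^sup>2"
      using adm k c1 by (fastforce simp: admissible_def dest: PiE_mem)
    have "(D0 - E) / d \<le> D0 / d"
      using E_nonneg d by (intro divide_right_mono) auto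
    then show "(D0 - E) / d \<le> noise \<sigma> N v k / (norm (v k))\<^sup>2"
      using k by linarith
  qed (use assms(1) d D_pos noise_nonneg in auto)
  finally show ?thesis
    using v unfolding D0_def E_def by blast
qed

end
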